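(* Let $F$ be a finite field with $q$ elements and let $A$ be a three-dimensional nonassociative division algebra over $F$ which is not isotopic to a commutative algebra. Let $0\ne v\in A^2$. If $v$ is nondegenerate, then $$\#\{Av'\mid v'\in A^2,\ v'\ne 0,\ Av\cap Av'=0\}=q^5-2q^3-3q^2-q.$$ If $v$ is degenerate, then $$\#\{Av'\mid v'\in A^2,\ v'\ne 0,\ Av\cap Av'=0\}=q^2(q^3+q^2-1).$$ (What is counted is the number of distinct subspaces $Av'$.)
   Context: A division algebra over $F$ is an $F$-vector space $A$ with a bilinear map $A\times A\to A$, $(x,y)\mapsto xy$, such that for every nonzero $a\in A$ the left multiplication $x\mapsto ax$ and the right multiplication $x\mapsto xa$ are bijections of $A$; no identity element is required. Nonassociative means that the multiplication is not associative. Two algebras $A,A'$ over $F$ are isotopic if there exist $F$-linear isomorphisms $f,g,h\colon A\to A'$ with $f(a)g(b)=h(ab)$ for all $a,b\in A$. $A^2=A\oplus A$, and $A$ acts on it by $a(x,y)=(ax,ay)$; for $v\in A^2$, $Av=\{av\mid a\in A\}$, an $F$-subspace of $A^2$. A vector $v=(x,y)\in A^2$ is nondegenerate if $x,y$ are linearly independent over $F$, and degenerate otherwise. *)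

theory Defs
  imports Complex_Main "HOL-Library.Product_Plus"
begin

text \<open>An algebra over a field: a vector space with a bilinear multiplication; neither associativity
  nor an identity element is required.\<close>

locale algebra_over = vector_space scale
  for scale :: "'f::field \<Rightarrow> 'a::ab_group_add \<Rightarrow> 'a" +
  fixes mult :: "'a \<Rightarrow> 'a \<Rightarrow> 'a"
  assumes linear_mult_left: "Vector_Spaces.linear scale scale (\<lambda>y. mult x y)"
    and linear_mult_right: "Vector_Spaces.linear scale scale (\<lambda>x. mult x y)"

locale division_algebra_over = algebra_over scale mult
  for scale :: "'f::field \<Rightarrow> 'a::ab_group_add \<Rightarrow> 'a" and mult :: "'a \<Rightarrow> 'a \<Rightarrow> 'a" +
  assumes bij_mult_left: "a \<noteq> 0 \<Longrightarrow> bij (\<lambda>x. mult a x)"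
    and bij_mult_right: "a \<noteq> 0 \<Longrightarrow> bij (\<lambda>x. mult x a)"

definition associative_mult :: "('a \<Rightarrow> 'a \<Rightarrow> 'a) \<Rightarrow> bool" where
  "associative_mult mult \<longleftrightarrow> (\<forall>a b c. mult (mult a b) c = mult a (mult b c))"

definition commutative_mult :: "('a \<Rightarrow> 'a \<Rightarrow> 'a) \<Rightarrow> bool" where
  "commutative_mult mult \<longleftrightarrow> (\<forall>a b. mult a b = mult b a)"

definition isotopic ::
  "('f::field \<Rightarrow> 'a::ab_group_add \<Rightarrow> 'a) \<Rightarrow> ('a \<Rightarrow> 'a \<Rightarrow> 'a) \<Rightarrow>
   ('f \<Rightarrow> 'b::ab_group_add \<Rightarrow> 'b) \<Rightarrow> ('b \<Rightarrow> 'b \<Rightarrow> 'b) \<Rightarrow> bool" where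
  "isotopic scale mult scale' mult' \<longleftrightarrow>
    (\<exists>f g h. Vector_Spaces.linear scale scale' f \<and> bij f \<and>
             Vector_Spaces.linear scale scale' g \<and> bij g \<and>
             Vector_Spaces.linear scale scale' h \<and> bij h \<and>
             (\<forall>a b. mult' (f a) (g b) = h (mult a b)))"

text \<open>The commutative algebra ranges over algebra structures on the additive group of \<open>'a\<close>, since a
  type cannot be quantified. The lemma below shows that this is no restriction: a commutative
  algebra on any type, isotopic to the given one, can be transported to \<open>'a\<close>.\<close>

definition isotopic_to_commutative ::
  "('f::field \<Rightarrow> 'a::ab_group_add \<Rightarrow> 'a) \<Rightarrow> ('a \<Rightarrow> 'a \<Rightarrow> 'a) \<Rightarrow> bool" where
  "isotopic_to_commutative scale mult \<longleftrightarrow>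
    (\<exists>(scale' :: 'f \<Rightarrow> 'a \<Rightarrow> 'a) (mult' :: 'a \<Rightarrow> 'a \<Rightarrow> 'a).
       algebra_over scale' mult' \<and> commutative_mult mult' \<and> isotopic scale mult scale' mult')"

lemma isotopic_to_commutativeI:
  fixes scale :: "'f::field \<Rightarrow> 'a::ab_group_add \<Rightarrow> 'a"
    and scale' :: "'f \<Rightarrow> 'b::ab_group_add \<Rightarrow> 'b"
  assumes A: "algebra_over scale mult" and B: "algebra_over scale' mult'"
    and comm: "commutative_mult mult'" and iso: "isotopic scale mult scale' mult'"
  shows "isotopic_to_commutative scale mult"
proof -
  obtain f g h where f: "Vector_Spaces.linear scale scale' f" "bij f"
    and g: "Vector_Spaces.linear scale scale' g" "bij g"
    and h: "Vector_Spaces.linear scale scale' h" "bij h"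
    and fgh: "\<And>a b. mult' (f a) (g b) = h (mult a b)"
    using iso unfolding isotopic_def by blast
  interpret A: algebra_over scale mult by (rule A)
  interpret B: algebra_over scale' mult' by (rule B)
  define k where "k = inv h"
  have hk: "h (k x) = x" for x
    unfolding k_def using h(2) by (simp add: bij_is_surj surj_f_inv_f)
  have kh: "k (h x) = x" for x
    unfolding k_def using h(2) by (simp add: bij_is_inj)
  have h_add: "h (x + y) = h x + h y" and h_scale: "h (scale r x) = scale' r (h x)" for x y r
    using h(1) by (simp_all add: Vector_Spaces.linear_iff)
  have "k (x + y) = k x + k y" for x y
    by (metis h_add hk kh)
  moreover have "k (scale' r x) = scale r (k x)" for r x
    by (metis h_scale hk kh)
  ultimately have k: "Vector_Spaces.linear scale' scale k" "bij k"
    using A.vector_space_axioms B.vector_space_axioms bij_imp_bij_inv[OF h(2)]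
    by (simp_all add: Vector_Spaces.linear_iff k_def)
  define m where "m = (\<lambda>a b. k (mult' (h a) (h b)))"
  have comp: "Vector_Spaces.linear scale scale (\<lambda>x. k (q (p x)))"
    if "Vector_Spaces.linear scale scale' p" "Vector_Spaces.linear scale' scale' q" for p q
    using Vector_Spaces.linear_compose[OF Vector_Spaces.linear_compose[OF that] k(1)]
    by (simp add: o_def)
  have "algebra_over scale m"
    unfolding m_def
    by (intro algebra_over.intro algebra_over_axioms.intro A.vector_space_axioms
        comp[OF h(1) B.linear_mult_left] comp[OF h(1) B.linear_mult_right])
  moreover have "commutative_mult m"
    using comm by (simp add: commutative_mult_def m_def)
  moreover have "isotopic scale mult scale m"
    unfolding isotopic_def
  proof (intro exI conjI allI)
    show "Vector_Spaces.linear scale scale (k \<circ> f)" "Vector_Spaces.linear scale scale (k \<circ> g)"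
      using Vector_Spaces.linear_compose f(1) g(1) k(1) by blast+
    show "bij (k \<circ> f)" "bij (k \<circ> g)"
      using f(2) g(2) k(2) by (auto intro: bij_comp)
    show "Vector_Spaces.linear scale scale id" by (rule A.linear_id)
    show "bij (id :: 'a \<Rightarrow> 'a)" by simp
    show "m ((k \<circ> f) a) ((k \<circ> g) b) = id (mult a b)" for a b
      by (simp add: m_def hk kh fgh)
  qed
  ultimately show ?thesis
    unfolding isotopic_to_commutative_def by blast
qed

definition act :: "('a \<Rightarrow> 'a \<Rightarrow> 'a) \<Rightarrow> 'a \<Rightarrow> 'a \<times> 'a \<Rightarrow> 'a \<times> 'a" where
  "act mult a v = (mult a (fst v), mult a (snd v))"

definition orbit_space :: "('a \<Rightarrow> 'a \<Rightarrow> 'a) \<Rightarrow> 'a \<times> 'a \<Rightarrow> ('a \<times> 'a) set" where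
  "orbit_space mult v = {act mult a v | a. True}"

text \<open>The inequality is needed because \<open>{x, x}\<close> is the singleton \<open>{x}\<close>, which is an independent set
  for \<open>x \<noteq> 0\<close>, whereas the family \<open>(x, x)\<close> is linearly dependent.\<close>

definition nondegenerate ::
  "('f::field \<Rightarrow> 'a::ab_group_add \<Rightarrow> 'a) \<Rightarrow> 'a \<times> 'a \<Rightarrow> bool" where
  "nondegenerate scale v \<longleftrightarrow>
    fst v \<noteq> snd v \<and> \<not> module.dependent scale {fst v, snd v}"

end

(* Suppose v is nondegenerate, v' is not a multiple of v, and dim (Av \<inter> Av') \<ge> 2. The solutions
   (a, b) of av = bv' and the coordinates of v, v' give planes W, U of A and injective linear maps
   T, S on them, without eigenvectors, such that a u = T(a) S(u) for a in W, u in U. As W and T(W)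
   meet, there are e_1, e_2 in W with T(e_1) = e_2; put e_3 = T(e_2), and define f_1, f_2, f_3 in
   the same way from S. Then e_i f_j = e_(i+1) f_(j+1). If both triples are bases, then
   e_i |-> f_(4-i) makes A isotopic to a commutative algebra; otherwise the relations contradict the
   invertibility of multiplications. Hence Av and Av' meet in dimension at most 1, and in particular
   Av determines v up to a scalar. Both counts follow by double counting; dimension arguments
   are replaced by |A| = q^3. *)

theory Submission
  imports Defs "HOL-Library.Cardinality"
begin

section \<open>Coordinates and counting in a three-dimensional division algebra over a finite
  field\<close>

lemma card_eq_fibre_mult:
  assumes "finite X" "\<And>x. x \<in> X \<Longrightarrow> card {y \<in> X. f y = f x} = k"
  shows "card X = k * card (f ` X)"
proof -
  have "card X = (\<Sum>z\<in>f ` X. \<Sum>x | x \<in> X \<and> f x = z. 1)"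
    using sum.image_gen[OF assms(1), of "\<lambda>_. 1::nat" f] by simp
  also have "\<dots> = (\<Sum>z\<in>f ` X. k)"
    using assms(2) by (intro sum.cong) (auto simp: conj_commute)
  finally show ?thesis by (simp add: mult.commute)
qed

locale cubic_division_algebra = division_algebra_over scale mult
  for scale :: "'f::{field,finite} \<Rightarrow> 'a::ab_group_add \<Rightarrow> 'a" (infixr "*s" 75)
    and mult :: "'a \<Rightarrow> 'a \<Rightarrow> 'a" (infixl "\<odot>" 70) +
  assumes dim_3: "dim (UNIV :: 'a set) = 3"
begin

lemma mult_add: "x \<odot> (y + z) = x \<odot> y + x \<odot> z" "(x + y) \<odot> z = x \<odot> z + y \<odot> z"
  and mult_scale: "x \<odot> (c *s y) = c *s (x \<odot> y)" "(c *s x) \<odot> y = c *s (x \<odot> y)"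
  using linear_mult_left linear_mult_right by (simp_all add: Vector_Spaces.linear_iff)

lemma mult_0 [simp]: "x \<odot> 0 = 0" "0 \<odot> x = 0"
  using mult_scale(1)[of x 0 0] mult_scale(2)[of 0 0 x] by simp_all

lemma mult_left_cancel: "a \<noteq> 0 \<Longrightarrow> a \<odot> x = a \<odot> y \<longleftrightarrow> x = y"
  using bij_mult_left[of a] by (metis bij_is_inj injD)

lemma mult_right_cancel: "a \<noteq> 0 \<Longrightarrow> x \<odot> a = y \<odot> a \<longleftrightarrow> x = y"
  using bij_mult_right[of a] by (metis bij_is_inj injD)

lemma mult_eq_0 [simp]: "x \<odot> y = 0 \<longleftrightarrow> x = 0 \<or> y = 0"
  using mult_left_cancel[of x y 0] by auto

text \<open>Injectivity of these coordinate maps expresses linear independence of a family, so a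
  repeated vector counts as dependent, and it combines directly with the domain sizes q^2 and
  q^3.\<close>

definition comb2 :: "'a \<Rightarrow> 'a \<Rightarrow> 'f \<times> 'f \<Rightarrow> 'a" where
  "comb2 x y k = fst k *s x + snd k *s y"

definition comb3 :: "'a \<Rightarrow> 'a \<Rightarrow> 'a \<Rightarrow> 'f \<times> 'f \<times> 'f \<Rightarrow> 'a" where
  "comb3 x y z k = fst k *s x + fst (snd k) *s y + snd (snd k) *s z"

lemma comb3_add: "comb3 x y z (k + l) = comb3 x y z k + comb3 x y z l"
  by (simp add: comb3_def scale_left_distrib algebra_simps)

lemma comb3_scale:
  "comb3 x y z (c * fst k, c * fst (snd k), c * snd (snd k)) = c *s comb3 x y z k"
  by (simp add: comb3_def scale_right_distrib)

lemma inj_comb3_iff: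
  "inj (comb3 x y z) \<longleftrightarrow>
    (\<forall>a b c. a *s x + b *s y + c *s z = 0 \<longrightarrow> a = 0 \<and> b = 0 \<and> c = 0)"
    (is "_ \<longleftrightarrow> ?R")
proof
  assume inj: "inj (comb3 x y z)"
  show ?R
  proof (intro allI impI)
    fix a b c assume "a *s x + b *s y + c *s z = 0"
    then have "comb3 x y z (a, b, c) = comb3 x y z (0, 0, 0)"
      by (simp add: comb3_def)
    then show "a = 0 \<and> b = 0 \<and> c = 0" using inj by (auto dest: injD)
  qed
next
  assume R: ?R
  show "inj (comb3 x y z)"
  proof (rule injI)
    fix k l assume "comb3 x y z k = comb3 x y z l"
    then have "comb3 x y z (k - l) = 0"
      using comb3_add[of x y z "k - l" l] by simp
    then have "(fst k - fst l) *s x + (fst (snd k) - fst (snd l)) *s y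
        + (snd (snd k) - snd (snd l)) *s z = 0"
      by (simp add: comb3_def)
    with R have "fst k - fst l = 0 \<and> fst (snd k) - fst (snd l) = 0 \<and> snd (snd k) - snd (snd l) = 0"
      by blast
    then show "k = l" by (simp add: prod_eq_iff)
  qed
qed

lemma inj_comb2_iff:
  "inj (comb2 x y) \<longleftrightarrow> (\<forall>a b. a *s x + b *s y = 0 \<longrightarrow> a = 0 \<and> b = 0)" (is "_ \<longleftrightarrow> ?R")
proof
  assume inj: "inj (comb2 x y)"
  show ?R
  proof (intro allI impI)
    fix a b assume "a *s x + b *s y = 0"
    then have "comb2 x y (a, b) = comb2 x y (0, 0)"
      by (simp add: comb2_def)
    then show "a = 0 \<and> b = 0" using inj by (auto dest: injD)
  qed
next
  assume R: ?R
  show "inj (comb2 x y)"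
  proof (rule injI)
    fix k l assume "comb2 x y k = comb2 x y l"
    then have "(fst k - fst l) *s x + (snd k - snd l) *s y = 0"
      by (simp add: comb2_def scale_left_diff_distrib algebra_simps)
    with R have "fst k - fst l = 0 \<and> snd k - snd l = 0" by blast
    then show "k = l" by (simp add: prod_eq_iff)
  qed
qed

lemma basis_exists_3: obtains x y z where "bij (comb3 x y z)"
proof -
  obtain B where B: "independent B" "UNIV \<subseteq> span B" "card B = 3"
    using basis_exists[of UNIV] dim_3 by metis
  then obtain x y z where xyz: "B = {x, y, z}" "x \<noteq> y" "x \<noteq> z" "y \<noteq> z"
    unfolding card_3_iff by metis
  have "inj (comb3 x y z)"
    unfolding inj_comb3_iff
  proof (intro allI impI)
    fix a b c assume 0: "a *s x + b *s y + c *s z = 0"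
    define u where "u w = (if w = x then a else if w = y then b else c)" for w
    have "(\<Sum>w\<in>B. u w *s w) = 0"
      using xyz 0 by (simp add: u_def add.assoc)
    then have "u w = 0" if "w \<in> B" for w
      using independentD[OF B(1), of B u w] xyz that by simp
    from this[of x] this[of y] this[of z] show "a = 0 \<and> b = 0 \<and> c = 0"
      using xyz by (auto simp: u_def)
  qed
  moreover have "w \<in> range (comb3 x y z)" for w
  proof -
    have "w \<in> span {x, y, z}" using B xyz by auto
    then obtain a b c where "w - a *s x - b *s y - c *s z = 0"
      unfolding span_insert by auto
    then have "w = comb3 x y z (a, b, c)"
      by (simp add: comb3_def algebra_simps)
    then show ?thesis by blast
  qed
  ultimately show ?thesis using that unfolding bij_def by blast
qed

lemma card_UNIV_eq: "CARD('a) = CARD('f) ^ 3"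
proof -
  obtain x y z where "bij (comb3 x y z)" by (rule basis_exists_3)
  from bij_betw_same_card[OF this] show ?thesis
    by (simp add: card_prod power3_eq_cube)
qed

lemma q_gt_1: "CARD('f) > 1"
  using card_mono[of UNIV "{0, 1 :: 'f}"] by simp

lemma finite_UNIV [simp]: "finite (UNIV :: 'a set)"
  using card_UNIV_eq q_gt_1 by (metis card.infinite less_zeroE power_not_zero neq0_conv)

lemma finite_algebra [simp]: "finite (S :: 'a set)" "finite (T :: ('a \<times> 'a) set)"
  by (auto intro: finite_subset[OF _ finite_UNIV] finite_subset[OF _ finite_cartesian_product[OF finite_UNIV finite_UNIV]])

text \<open>Source and target both have q^3 elements.\<close>

lemma bij_comb3: "inj (comb3 x y z) \<Longrightarrow> bij (comb3 x y z)"
  using inj_on_iff_eq_card[of UNIV "comb3 x y z"] card_UNIV_eq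
    card_subset_eq[OF finite_UNIV, of "range (comb3 x y z)"]
  by (simp add: bij_def card_prod power3_eq_cube)

text \<open>There are q^4 coefficient tuples but only q^3 vectors, so two tuples collide and their
  difference is a relation. The two-sided form yields a common vector of the planes spanned by x, y
  and by z, w.\<close>

lemma dependent_four:
  obtains a b c d where "a *s x + b *s y = c *s z + d *s w" "\<not> (a = 0 \<and> b = 0 \<and> c = 0 \<and> d = 0)"
proof -
  define h where "h = (\<lambda>(k, l). comb2 x y k - comb2 z w l)"
  have "\<not> inj h"
  proof
    assume "inj h"
    then have "CARD(('f \<times> 'f) \<times> ('f \<times> 'f)) \<le> CARD('a)"
      by (intro card_inj_on_le[of h]) auto
    then have "CARD('f) ^ 4 \<le> CARD('f) ^ 3"
      by (simp add: card_prod card_UNIV_eq power4_eq_xxxx mult.assoc)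
    then show False using q_gt_1 by simp
  qed
  then obtain k l k' l' where "h (k, l) = h (k', l')" and ne: "(k, l) \<noteq> (k', l')"
    unfolding inj_def by auto
  then have "(fst k - fst k') *s x + (snd k - snd k') *s y
      = (fst l - fst l') *s z + (snd l - snd l') *s w"
    by (simp add: h_def comb2_def scale_left_diff_distrib algebra_simps)
  from that[OF this] ne show ?thesis by (auto simp: prod_eq_iff)
qed

section \<open>Two spaces Av, Aw sharing a plane\<close>

text \<open>The relations say that \<open>e\<^sub>if\<^sub>j\<close> depends only on \<open>i - j\<close>, except that \<open>(1,3)\<close> and \<open>(3,1)\<close>
  are alone on their diagonals. Hence \<open>e\<^sub>if\<^bsub>4-j\<^esub>\<close> is symmetric in \<open>i\<close> and \<open>j\<close>.\<close>

lemma isotopic_to_commutative_of_chains: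
  assumes e: "inj (comb3 e1 e2 e3)" and f: "inj (comb3 f1 f2 f3)"
    and rel: "e1 \<odot> f1 = e2 \<odot> f2" "e1 \<odot> f2 = e2 \<odot> f3" "e2 \<odot> f1 = e3 \<odot> f2" "e2 \<odot> f2 = e3 \<odot> f3"
  shows "isotopic_to_commutative scale mult"
proof -
  let ?E = "comb3 e1 e2 e3" and ?G = "comb3 f3 f2 f1"
  have "inj ?G" using f unfolding inj_comb3_iff by (metis add.commute add.left_commute)
  then have bij: "bij ?E" "bij ?G" using e by (auto intro: bij_comb3)
  define g where "g = (\<lambda>x. ?G (inv ?E x))"
  define g' where "g' = (\<lambda>x. ?E (inv ?G x))"
  have gE: "g (?E k) = ?G k" for k using bij by (simp add: g_def bij_is_inj)
  have gg': "g (g' x) = x" for x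
    using bij by (simp add: g'_def gE bij_is_surj surj_f_inv_f)
  have g'g: "g' (g x) = x" for x
    using bij by (simp add: g'_def g_def bij_is_surj bij_is_inj surj_f_inv_f)
  have surjE: "\<exists>k. x = ?E k" for x using bij by (metis bij_pointE)
  have g_add: "g (x + y) = g x + g y" for x y
    using surjE[of x] surjE[of y] by (auto simp: gE simp flip: comb3_add)
  have g_scale: "g (c *s x) = c *s g x" for c x
    using surjE[of x] by (auto simp: gE simp flip: comb3_scale)
  have g'_add: "g' (x + y) = g' x + g' y" for x y by (metis g_add gg' g'g)
  have g'_scale: "g' (c *s x) = c *s g' x" for c x by (metis g_scale gg' g'g)
  define m where "m = (\<lambda>x y. x \<odot> g y)"
  have "algebra_over scale m"
    by unfold_locales
      (auto simp: m_def mult_add mult_scale g_add g_scale scale_right_distrib scale_left_distrib)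
  moreover have "commutative_mult m"
    unfolding commutative_mult_def
  proof (intro allI)
    fix x y
    obtain k l where "x = ?E k" "y = ?E l" using surjE by metis
    then have "m x y = ?E k \<odot> ?G l" "m y x = ?E l \<odot> ?G k" by (simp_all add: m_def gE)
    then show "m x y = m y x"
      by (simp add: comb3_def mult_add mult_scale rel scale_right_distrib algebra_simps)
  qed
  moreover have "isotopic scale mult scale m"
    unfolding isotopic_def
  \<comment> \<open>Only the second argument is twisted: \<open>g'\<close> inverts \<open>g\<close>,
    so \<open>m a (g' b)\<close> is \<open>a \<odot> b\<close>.\<close>
  proof (rule exI[of _ id], rule exI[of _ g'], rule exI[of _ id], intro conjI allI)
    show "bij (id :: 'a \<Rightarrow> 'a)" "bij (id :: 'a \<Rightarrow> 'a)" by simp_all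
    show "Vector_Spaces.linear scale scale id" "Vector_Spaces.linear scale scale id"
      by (rule linear_id)+
    show "bij g'" using gg' g'g by (intro o_bij[of g]) (auto simp: o_def)
    show "Vector_Spaces.linear scale scale g'"
      by unfold_locales (auto simp: g'_add g'_scale scale_right_distrib scale_left_distrib)
    show "m (id a) (g' b) = id (a \<odot> b)" for a b
      by (simp add: m_def gg')
  qed
  ultimately show ?thesis unfolding isotopic_to_commutative_def by blast
qed

lemma comb2_eq_0: "inj (comb2 x y) \<Longrightarrow> comb2 x y k = 0 \<longleftrightarrow> k = 0"
  by (auto simp: inj_comb2_iff comb2_def prod_eq_iff)

lemma inj_comb2D:
  assumes "inj (comb2 x y)"
  shows "x \<noteq> 0" "y \<noteq> 0" "y \<noteq> c *s x" "x \<noteq> c *s y"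
  using comb2_eq_0[OF assms, of "(1, 0)"] comb2_eq_0[OF assms, of "(0, 1)"]
    comb2_eq_0[OF assms, of "(c, - 1)"] comb2_eq_0[OF assms, of "(- 1, c)"]
  by (auto simp: comb2_def prod_eq_iff)

lemma inj_comb2_iff_not_multiple:
  "inj (comb2 x y) \<longleftrightarrow> x \<noteq> 0 \<and> (\<forall>c. y \<noteq> c *s x)"
proof
  assume R: "x \<noteq> 0 \<and> (\<forall>c. y \<noteq> c *s x)"
  show "inj (comb2 x y)"
    unfolding inj_comb2_iff
  proof (intro allI impI)
    fix a b assume 0: "a *s x + b *s y = 0"
    have "b = 0"
    proof (rule ccontr)
      assume "b \<noteq> 0"
      then have "y = inverse b *s (b *s y)" by simp
      also have "b *s y = - a *s x" using 0 by (simp add: eq_neg_iff_add_eq_0 add.commute)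
      finally have "y = (inverse b * - a) *s x" by simp
      with R show False by blast
    qed
    then show "a = 0 \<and> b = 0" using 0 R by simp
  qed
qed (use inj_comb2D in blast)

lemma independent_pair_exists: obtains x y where "inj (comb2 x y)"
proof -
  obtain x y z where "inj (comb3 x y z)" using basis_exists_3 bij_is_inj by metis
  then have "inj (comb2 x y)"
    unfolding inj_comb3_iff inj_comb2_iff by (metis add.right_neutral scale_zero_left)
  then show ?thesis by (rule that)
qed

lemma inj_comb3_extend:
  assumes "inj (comb2 x y)" "z \<notin> range (comb2 x y)"
  shows "inj (comb3 x y z)"
  unfolding inj_comb3_iff
proof (intro allI impI)
  fix a b c assume 0: "a *s x + b *s y + c *s z = 0"
  have "c = 0"
  proof (rule ccontr)
    assume "c \<noteq> 0"
    then have "z = inverse c *s (c *s z)" by simp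
    also have "c *s z = - (a *s x + b *s y)" using 0 by (simp only: eq_neg_iff_add_eq_0 add.commute)
    also have "inverse c *s \<dots> = comb2 x y (- inverse c * a, - inverse c * b)"
      by (simp add: comb2_def scale_right_distrib scale_right_diff_distrib)
    finally show False using assms(2) by blast
  qed
  then show "a = 0 \<and> b = 0 \<and> c = 0"
    using 0 comb2_eq_0[OF assms(1), of "(a, b)"] by (simp add: comb2_def prod_eq_iff)
qed

lemma card_range_comb2: "card (range (comb2 x y)) < CARD('a)"
proof -
  have "card (range (comb2 x y)) \<le> CARD('f) ^ 2"
    using card_image_le[of UNIV "comb2 x y"] by (simp add: card_prod power2_eq_square)
  also have "\<dots> < CARD('a)" using q_gt_1 by (simp add: card_UNIV_eq)
  finally show ?thesis .
qed

text \<open>If \<open>e\<^sub>3\<close> were in \<open>\<langle>e\<^sub>1, e\<^sub>2\<rangle>\<close>, all products of \<open>\<langle>e\<^sub>1, e\<^sub>2\<rangle>\<close> and \<open>\<langle>f\<^sub>1, f\<^sub>2\<rangle>\<close> would lie in the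
  plane \<open>Z = e\<^sub>1\<langle>f\<^sub>1, f\<^sub>2\<rangle>\<close>. For \<open>w\<close> outside \<open>\<langle>e\<^sub>1, e\<^sub>2\<rangle>\<close>, the planes \<open>w\<langle>f\<^sub>1, f\<^sub>2\<rangle>\<close> and \<open>Z\<close> meet in some
  \<open>wu \<noteq> 0\<close>, so right multiplication by \<open>u\<close> maps the whole algebra into \<open>Z\<close>.\<close>

lemma chain_not_closed:
  assumes e: "inj (comb2 e1 e2)" and f: "inj (comb2 f1 f2)"
    and rel: "e1 \<odot> f1 = e2 \<odot> f2" "e1 \<odot> f2 = e2 \<odot> f3" "e2 \<odot> f1 = e3 \<odot> f2" "e2 \<odot> f2 = e3 \<odot> f3"
  shows "e3 \<notin> range (comb2 e1 e2)"
proof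
  assume "e3 \<in> range (comb2 e1 e2)"
  then obtain s t where e3: "e3 = s *s e1 + t *s e2" by (auto simp: comb2_def)
  let ?Z = "(\<odot>) e1 ` range (comb2 f1 f2)"
  \<comment> \<open>e2 f1 = e3 f2 = s(e1 f2) + t(e2 f2), and e2 f2 = e1 f1.\<close>
  have e2f1: "e2 \<odot> f1 = e1 \<odot> (s *s f2 + t *s f1)"
    using rel by (simp add: e3 mult_add mult_scale)
  obtain w where w: "w \<notin> range (comb2 e1 e2)"
    using card_range_comb2[of e1 e2] by (metis UNIV_eq_I less_irrefl)
  obtain a b c d where "a *s (w \<odot> f1) + b *s (w \<odot> f2) = c *s (e1 \<odot> f1) + d *s (e1 \<odot> f2)"
    and ne: "\<not> (a = 0 \<and> b = 0 \<and> c = 0 \<and> d = 0)"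
    by (rule dependent_four)
  moreover define u where "u = a *s f1 + b *s f2"
  ultimately have wu: "w \<odot> u = e1 \<odot> (c *s f1 + d *s f2)"
    by (simp add: mult_add mult_scale)
  have "u \<noteq> 0"
  proof
    assume u: "u = 0"
    with wu have "c *s f1 + d *s f2 = 0" using inj_comb2D(1)[OF e] by simp
    with u ne f show False unfolding u_def inj_comb2_iff by blast
  qed
  have "z \<in> ?Z" for z
  proof -
    obtain x where x: "z = x \<odot> u" using bij_mult_right[OF \<open>u \<noteq> 0\<close>] by (metis bij_pointE)
    obtain k where k: "x = comb3 e1 e2 w k"
      using bij_comb3[OF inj_comb3_extend[OF e w]] by (metis bij_pointE)
    have "e2 \<odot> u = e1 \<odot> (a *s (s *s f2 + t *s f1) + b *s f1)"
      by (simp add: u_def mult_add mult_scale e2f1 rel(1))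
    then have "z = e1 \<odot> (fst k *s u + fst (snd k) *s (a *s (s *s f2 + t *s f1) + b *s f1)
        + snd (snd k) *s (c *s f1 + d *s f2))"
      by (simp add: x k comb3_def mult_add mult_scale wu)
    also have "\<dots> = e1 \<odot> comb2 f1 f2
        (fst k * a + fst (snd k) * (a * t + b) + snd (snd k) * c,
         fst k * b + fst (snd k) * (a * s) + snd (snd k) * d)"
      by (rule arg_cong[of _ _ "(\<odot>) e1"])
        (simp add: comb2_def u_def scale_right_distrib scale_left_distrib algebra_simps)
    finally show ?thesis by blast
  qed
  then have "CARD('a) \<le> card ?Z" by (intro card_mono) auto
  also have "\<dots> \<le> card (range (comb2 f1 f2))" by (intro card_image_le) simp
  finally show False using card_range_comb2[of f1 f2] by simp
qed

text \<open>Two planes of a three-dimensional space share a nonzero vector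
  \<open>comb2 w1 w2 p\<close>. It is the image of \<open>comb2 z1 z2 p\<close> under the linear map
  sending z1, z2 to w1, w2. As this map has no eigenvectors, argument and image are
  independent.\<close>

lemma chain_exists:
  assumes inj: "inj (comb2 z1 z2)" "inj (comb2 w1 w2)"
    and no_eigen: "\<And>p c. p \<noteq> 0 \<Longrightarrow> comb2 w1 w2 p \<noteq> c *s comb2 z1 z2 p"
  obtains p p' where "comb2 w1 w2 p = comb2 z1 z2 p'"
    "inj (comb2 (comb2 z1 z2 p) (comb2 z1 z2 p'))"
proof -
  obtain a b c d where eq: "a *s w1 + b *s w2 = c *s z1 + d *s z2"
    and ne: "\<not> (a = 0 \<and> b = 0 \<and> c = 0 \<and> d = 0)"
    by (rule dependent_four)
  define p p' where "p = (a, b)" and "p' = (c, d)"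
  have eq': "comb2 w1 w2 p = comb2 z1 z2 p'" using eq by (simp add: p_def p'_def comb2_def)
  have "p \<noteq> 0"
  proof
    assume "p = 0"
    then have "p' = 0" using eq' comb2_eq_0[OF inj(1), of p'] comb2_eq_0[OF inj(2), of p] by simp
    with \<open>p = 0\<close> ne show False by (simp add: p_def p'_def prod_eq_iff)
  qed
  have "inj (comb2 (comb2 z1 z2 p) (comb2 z1 z2 p'))"
    unfolding inj_comb2_iff_not_multiple
    using no_eigen[OF \<open>p \<noteq> 0\<close>] comb2_eq_0[OF inj(1)] \<open>p \<noteq> 0\<close> by (simp flip: eq')
  with eq' show ?thesis by (rule that)
qed

text \<open>With v = (x1, x2) and w = (y1, y2), the relations say that a1 v = b1 w and a2 v = b2 w:
  Av and Aw share two independent vectors. The conclusion is that w lies in Fv.\<close>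

lemma shared_products_imp_proportional:
  assumes noncomm: "\<not> isotopic_to_commutative scale mult"
    and inj: "inj (comb2 a1 a2)" "inj (comb2 b1 b2)" "inj (comb2 x1 x2)" "inj (comb2 y1 y2)"
    and rel: "a1 \<odot> x1 = b1 \<odot> y1" "a1 \<odot> x2 = b1 \<odot> y2" "a2 \<odot> x1 = b2 \<odot> y1" "a2 \<odot> x2 = b2 \<odot> y2"
  shows "\<exists>c. y1 = c *s x1 \<and> y2 = c *s x2"
proof (rule ccontr)
  assume noprop: "\<nexists>c. y1 = c *s x1 \<and> y2 = c *s x2"
  let ?\<alpha> = "comb2 a1 a2" and ?\<beta> = "comb2 b1 b2" and ?\<xi> = "comb2 x1 x2" and ?\<eta> = "comb2 y1 y2"
  \<comment> \<open>The maps T: \<open>?\<alpha> p\<close> to \<open>?\<beta> p\<close> and S: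
    \<open>?\<xi> r\<close> to \<open>?\<eta> r\<close> satisfy au = T(a)S(u), by
    bilinearity.\<close>
  have H: "?\<alpha> p \<odot> ?\<xi> r = ?\<beta> p \<odot> ?\<eta> r" for p r
    by (simp add: comb2_def mult_add mult_scale rel)
  \<comment> \<open>An eigenvector of T can be cancelled from au = T(a)S(u); then u = c S(u) for all
    u, so S is a scalar, against \<open>noprop\<close>.\<close>
  have no_eigen1: "?\<beta> p \<noteq> c *s ?\<alpha> p" if "p \<noteq> 0" for p c
  proof
    assume "?\<beta> p = c *s ?\<alpha> p"
    then have "?\<alpha> p \<odot> ?\<xi> r = ?\<alpha> p \<odot> (c *s ?\<eta> r)" for r
      by (simp add: H mult_scale)
    then have *: "?\<xi> r = c *s ?\<eta> r" for r
      using mult_left_cancel comb2_eq_0[OF inj(1)] that by blast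
    from *[of "(1, 0)"] *[of "(0, 1)"] have "x1 = c *s y1" "x2 = c *s y2"
      by (simp_all add: comb2_def)
    moreover from this have "c \<noteq> 0" using inj_comb2D(1)[OF inj(3)] by auto
    ultimately have "y1 = inverse c *s x1 \<and> y2 = inverse c *s x2" by simp
    with noprop show False by blast
  qed
  \<comment> \<open>Cancelling an eigenvector of S on the right would in turn make T a
    scalar.\<close>
  have no_eigen2: "?\<eta> r \<noteq> c *s ?\<xi> r" if "r \<noteq> 0" for r c
  proof
    assume "?\<eta> r = c *s ?\<xi> r"
    then have "?\<alpha> p \<odot> ?\<xi> r = (c *s ?\<beta> p) \<odot> ?\<xi> r" for p
      by (simp add: H mult_scale)
    then have "?\<alpha> p = c *s ?\<beta> p" for p
      using mult_right_cancel comb2_eq_0[OF inj(3)] that by blast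
    then have *: "?\<alpha> (1, 0) = c *s ?\<beta> (1, 0)" .
    then have "c \<noteq> 0" using comb2_eq_0[OF inj(1), of "(1, 0)"] by (auto simp: prod_eq_iff)
    with * have "?\<beta> (1, 0) = inverse c *s ?\<alpha> (1, 0)" by simp
    then show False using no_eigen1[of "(1, 0)"] by (simp add: prod_eq_iff)
  qed
  obtain p p' where p: "?\<beta> p = ?\<alpha> p'" and e: "inj (comb2 (?\<alpha> p) (?\<alpha> p'))"
    by (rule chain_exists[OF inj(1,2) no_eigen1])
  obtain r r' where r: "?\<eta> r = ?\<xi> r'" and f: "inj (comb2 (?\<xi> r) (?\<xi> r'))"
    by (rule chain_exists[OF inj(3,4) no_eigen2])
  define e1 e2 e3 where "e1 = ?\<alpha> p" and "e2 = ?\<alpha> p'" and "e3 = ?\<beta> p'"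
  define f1 f2 f3 where "f1 = ?\<xi> r" and "f2 = ?\<xi> r'" and "f3 = ?\<eta> r'"
  note defs = e1_def e2_def e3_def f1_def f2_def f3_def
  have rel: "e1 \<odot> f1 = e2 \<odot> f2" "e1 \<odot> f2 = e2 \<odot> f3" "e2 \<odot> f1 = e3 \<odot> f2" "e2 \<odot> f2 = e3 \<odot> f3"
    unfolding defs using H[of p r] H[of p r'] H[of p' r] H[of p' r'] by (simp_all add: p r)
  have e: "inj (comb2 e1 e2)" and f: "inj (comb2 f1 f2)" using e f by (simp_all add: defs)
  have e3: "e3 \<notin> range (comb2 e1 e2)" by (rule chain_not_closed[OF e f rel])
  \<comment> \<open>This case reduces to the one for e3: e1 f1 = e3 f3 = (s e3 + t e2) f1, and after
    cancelling f1 the coefficient s is nonzero because e1, e2 are independent, so e3 would lie in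
    their span.\<close>
  have "f3 \<notin> range (comb2 f1 f2)"
  proof
    assume "f3 \<in> range (comb2 f1 f2)"
    then obtain s t where f3: "f3 = s *s f1 + t *s f2" by (auto simp: comb2_def)
    have "e1 \<odot> f1 = (s *s e3 + t *s e2) \<odot> f1"
      using rel by (simp add: f3 mult_add mult_scale)
    then have e1: "e1 = s *s e3 + t *s e2"
      using mult_right_cancel inj_comb2D(1)[OF f] by blast
    then have "s \<noteq> 0" using inj_comb2D(4)[OF e, of t] by auto
    have "e3 = inverse s *s (s *s e3)" using \<open>s \<noteq> 0\<close> by simp
    also have "s *s e3 = e1 - t *s e2" using e1 by simp
    also have "inverse s *s \<dots> = comb2 e1 e2 (inverse s, - inverse s * t)"
      by (simp add: comb2_def scale_right_diff_distrib)
    finally show False using e3 by blast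
  qed
  then show False
    using isotopic_to_commutative_of_chains[OF inj_comb3_extend[OF e e3] inj_comb3_extend[OF f] rel] noncomm
    by blast
qed

section \<open>The action on pairs and the spaces Av\<close>

lemma nondegenerate_iff: "nondegenerate scale v \<longleftrightarrow> inj (comb2 (fst v) (snd v))"
proof -
  have "nondegenerate scale v \<longleftrightarrow> fst v \<noteq> snd v \<and> independent (insert (snd v) {fst v})"
    by (simp add: nondegenerate_def insert_commute)
  also have "\<dots> \<longleftrightarrow> fst v \<noteq> 0 \<and> (\<forall>c. snd v \<noteq> c *s fst v)"
    by (auto simp: independent_insert span_singleton) (metis scale_one)
  finally show ?thesis unfolding inj_comb2_iff_not_multiple .
qed

definition scale_pair :: "'f \<Rightarrow> 'a \<times> 'a \<Rightarrow> 'a \<times> 'a" where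
  "scale_pair c v = (c *s fst v, c *s snd v)"

lemma act_scale_pair: "act mult (c *s a) v = scale_pair c (act mult a v)"
  "act mult a (scale_pair c v) = scale_pair c (act mult a v)"
  by (simp_all add: act_def scale_pair_def mult_scale)

lemma act_eq_0 [simp]: "act mult a v = 0 \<longleftrightarrow> a = 0 \<or> v = 0"
  by (auto simp: act_def prod_eq_iff)

lemma act_left_cancel: "a \<noteq> 0 \<Longrightarrow> act mult a v = act mult a w \<longleftrightarrow> v = w"
  by (simp add: act_def prod_eq_iff mult_left_cancel)

lemma act_right_cancel: "v \<noteq> 0 \<Longrightarrow> act mult a v = act mult b v \<longleftrightarrow> a = b"
  by (auto simp: act_def prod_eq_iff mult_right_cancel)

lemma scale_pair_eq_0 [simp]: "scale_pair c v = 0 \<longleftrightarrow> c = 0 \<or> v = 0"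
  by (auto simp: scale_pair_def prod_eq_iff)

lemma scale_pair_scale_pair [simp]: "scale_pair c (scale_pair d v) = scale_pair (c * d) v"
  "scale_pair 1 v = v"
  by (simp_all add: scale_pair_def)

lemma scale_pair_inverse: "v = scale_pair c w \<Longrightarrow> v \<noteq> 0 \<Longrightarrow> c \<noteq> 0 \<and> w = scale_pair (inverse c) v"
  by auto

lemma nondegenerate_nonzero: "nondegenerate scale v \<Longrightarrow> v \<noteq> 0"
  by (auto simp: nondegenerate_iff dest: inj_comb2D(1))

text \<open>With v = (x, y) and w = (x', y'), a(sx + ty) = b(sx' + ty') for all scalars s, t. Hence
  every linear relation between the coordinates of w also holds for those of v.\<close>

lemma nondegenerate_transport:
  assumes "nondegenerate scale v" "act mult a v = act mult b w" "a \<noteq> 0"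
  shows "nondegenerate scale w"
  unfolding nondegenerate_iff inj_comb2_iff
proof (intro allI impI)
  fix s t assume 0: "s *s fst w + t *s snd w = 0"
  have "a \<odot> (s *s fst v + t *s snd v) = b \<odot> (s *s fst w + t *s snd w)"
    using assms(2) by (simp add: act_def mult_add mult_scale)
  then have "s *s fst v + t *s snd v = 0" using 0 assms(3) by simp
  then show "s = 0 \<and> t = 0"
    using assms(1) unfolding nondegenerate_iff inj_comb2_iff by blast
qed

lemma nondegenerate_scale_pair:
  assumes "nondegenerate scale v" "c \<noteq> 0"
  shows "nondegenerate scale (scale_pair c v)"
proof -
  obtain a :: 'a where "a \<noteq> 0" using independent_pair_exists inj_comb2D(1) by metis
  then have "act mult (c *s a) v = act mult a (scale_pair c v)" "c *s a \<noteq> 0"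
    using assms by (simp_all add: act_scale_pair)
  then show ?thesis using nondegenerate_transport assms(1) by blast
qed

text \<open>The vectors av and a'v span a plane inside the intersection of Av and Aw. Since v and w
  are nondegenerate and b, b' inherit independence from a, a', the result on shared products
  applies.\<close>

lemma shared_acts_imp_proportional:
  assumes noncomm: "\<not> isotopic_to_commutative scale mult"
    and v: "nondegenerate scale v" and a: "inj (comb2 a a')"
    and eq: "act mult a v = act mult b w" "act mult a' v = act mult b' w"
  shows "\<exists>c. w = scale_pair c v"
proof -
  have w: "nondegenerate scale w"
    using nondegenerate_transport[OF v eq(1)] inj_comb2D(1)[OF a] by blast
  have "inj (comb2 b b')"
    unfolding inj_comb2_iff
  proof (intro allI impI)
    fix s t assume 0: "s *s b + t *s b' = 0"
    have "(s *s a + t *s a') \<odot> fst v = (s *s b + t *s b') \<odot> fst w"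
      using eq by (simp add: act_def mult_add mult_scale)
    moreover have "fst v \<noteq> 0" using v inj_comb2D(1) unfolding nondegenerate_iff by blast
    ultimately have "s *s a + t *s a' = 0" using 0 by simp
    then show "s = 0 \<and> t = 0" using a unfolding inj_comb2_iff by blast
  qed
  then obtain c where "fst w = c *s fst v" "snd w = c *s snd v"
    using shared_products_imp_proportional[OF noncomm a, of b b' "fst v" "snd v" "fst w" "snd w"]
      v w eq by (auto simp: nondegenerate_iff act_def)
  then have "w = scale_pair c v" by (simp add: scale_pair_def prod_eq_iff)
  then show ?thesis by blast
qed

lemma mem_orbit_space: "p \<in> orbit_space mult v \<longleftrightarrow> (\<exists>a. p = act mult a v)"
  by (auto simp: orbit_space_def)

lemma zero_mem_orbit_space [simp]: "0 \<in> orbit_space mult v"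
  unfolding mem_orbit_space by (metis act_eq_0)

lemma orbit_space_neq_0: "v \<noteq> 0 \<Longrightarrow> orbit_space mult v \<noteq> {0}"
  using independent_pair_exists inj_comb2D(1) mem_orbit_space act_eq_0 by (metis singletonD)

lemma orbit_spaces_meet_iff:
  "orbit_space mult v \<inter> orbit_space mult w \<noteq> {0} \<longleftrightarrow>
    (\<exists>a b. act mult a v = act mult b w \<and> act mult a v \<noteq> 0)"
proof -
  have "orbit_space mult v \<inter> orbit_space mult w \<noteq> {0} \<longleftrightarrow>
      (\<exists>p. p \<in> orbit_space mult v \<and> p \<in> orbit_space mult w \<and> p \<noteq> 0)"
    using zero_mem_orbit_space by blast
  then show ?thesis unfolding mem_orbit_space by metis
qed

lemma orbit_space_scale_pair:
  assumes "c \<noteq> 0"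
  shows "orbit_space mult (scale_pair c v) = orbit_space mult v"
proof -
  have "act mult a v = act mult (inverse c *s a) (scale_pair c v)" for a
    using assms by (simp add: act_scale_pair)
  moreover have "act mult a (scale_pair c v) = act mult (c *s a) v" for a
    by (simp add: act_scale_pair)
  ultimately show ?thesis unfolding set_eq_iff mem_orbit_space by metis
qed

text \<open>Equal spaces share av and a'v for any independent a, a', which already forces w into
  Fv.\<close>

lemma orbit_space_eq_iff:
  assumes noncomm: "\<not> isotopic_to_commutative scale mult"
    and v: "nondegenerate scale v" and w: "w \<noteq> 0"
  shows "orbit_space mult w = orbit_space mult v \<longleftrightarrow> (\<exists>c. c \<noteq> 0 \<and> w = scale_pair c v)"
proof
  assume eq: "orbit_space mult w = orbit_space mult v"
  obtain a a' where a: "inj (comb2 a a')" by (rule independent_pair_exists)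
  have "act mult a v \<in> orbit_space mult w" "act mult a' v \<in> orbit_space mult w"
    unfolding eq mem_orbit_space by blast+
  then obtain c where "w = scale_pair c v"
    using shared_acts_imp_proportional[OF noncomm v a] unfolding mem_orbit_space by blast
  with w show "\<exists>c. c \<noteq> 0 \<and> w = scale_pair c v" by auto
qed (auto simp: orbit_space_scale_pair)

section \<open>Counting the spaces of nondegenerate vectors\<close>

lemma card_scale_pair_orbit:
  assumes "v \<noteq> 0"
  shows "card ((\<lambda>c. scale_pair c v) ` (- {0})) = CARD('f) - 1"
proof -
  have "inj (\<lambda>c. scale_pair c v)"
    using assms by (auto simp: inj_def scale_pair_def prod_eq_iff)
  then have "card ((\<lambda>c. scale_pair c v) ` (- {0})) = card (- {0 :: 'f})"
    by (meson card_image inj_on_subset subset_UNIV)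
  then show ?thesis by (simp add: Compl_eq_Diff_UNIV card_Diff_subset)
qed

text \<open>The nonzero scalars act freely on nonzero pairs, so each fibre has q - 1 elements. This
  serves for the map from w to Aw and for the map from (a, b) to the vector w with bw = av.\<close>

lemma card_eq_scale_pair_mult:
  assumes "0 \<notin> X"
    and "\<And>v w. v \<in> X \<Longrightarrow> w \<in> X \<and> f w = f v \<longleftrightarrow> (\<exists>c. c \<noteq> 0 \<and> w = scale_pair c v)"
  shows "card X = (CARD('f) - 1) * card (f ` X)"
proof (rule card_eq_fibre_mult)
  fix v assume v: "v \<in> X"
  then have "{w \<in> X. f w = f v} = (\<lambda>c. scale_pair c v) ` (- {0})"
    using assms(2)[OF v] by auto
  with v assms(1) show "card {w \<in> X. f w = f v} = CARD('f) - 1"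
    using card_scale_pair_orbit[of v] by auto
qed simp

text \<open>The first coordinate is any nonzero x, the second any vector off the line Fx.\<close>

lemma card_nondegenerate:
  "card {v. nondegenerate scale v} = (CARD('f) ^ 3 - 1) * (CARD('f) ^ 3 - CARD('f))"
proof -
  have "{v. nondegenerate scale v} = (SIGMA x:- {0}. - range (\<lambda>c. c *s x))"
    by (auto simp: nondegenerate_iff inj_comb2_iff_not_multiple)
  moreover have "card (- range (\<lambda>c. c *s x)) = CARD('f) ^ 3 - CARD('f)" if "x \<noteq> 0" for x
  proof -
    have "inj (\<lambda>c. c *s x)" using that by (auto simp: inj_def)
    then show ?thesis by (simp add: Compl_eq_Diff_UNIV card_Diff_subset card_image card_UNIV_eq)
  qed
  ultimately show ?thesis by (simp add: Compl_eq_Diff_UNIV card_Diff_subset card_UNIV_eq)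
qed

lemma card_nondegenerate_orbit_spaces:
  assumes "\<not> isotopic_to_commutative scale mult"
  shows "(CARD('f) - 1) * card (orbit_space mult ` {v. nondegenerate scale v})
    = (CARD('f) ^ 3 - 1) * (CARD('f) ^ 3 - CARD('f))"
  unfolding card_nondegenerate[symmetric]
proof (rule card_eq_scale_pair_mult[symmetric])
  show "0 \<notin> {v. nondegenerate scale v}" using nondegenerate_nonzero by blast
  fix v w assume "v \<in> {v. nondegenerate scale v}"
  then show "w \<in> {v. nondegenerate scale v} \<and> orbit_space mult w = orbit_space mult v
      \<longleftrightarrow> (\<exists>c. c \<noteq> 0 \<and> w = scale_pair c v)"
    using orbit_space_eq_iff[OF assms, of v w] nondegenerate_nonzero nondegenerate_scale_pair
    by blast
qed

section \<open>The spaces of degenerate vectors\<close>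

text \<open>One space for each point of the projective line over F: the graphs of the scalar
  multiplications and the vertical space.\<close>

definition lines :: "('a \<times> 'a) set set" where
  "lines = insert ({0} \<times> UNIV) (range (\<lambda>c. range (\<lambda>a. (a, c *s a))))"

lemma card_lines: "card lines = CARD('f) + 1"
proof -
  obtain x :: 'a where x: "x \<noteq> 0" using independent_pair_exists inj_comb2D(1) by metis
  have "inj (\<lambda>c. range (\<lambda>a. (a, c *s a)))"
  proof (rule injI)
    fix c d assume "range (\<lambda>a. (a, c *s a)) = range (\<lambda>a. (a, d *s a))"
    then have "(x, c *s x) \<in> range (\<lambda>a. (a, d *s a))" by blast
    then show "c = d" using x by auto
  qed
  moreover have "{0} \<times> UNIV \<notin> range (\<lambda>c. range (\<lambda>a. (a, c *s a)))"
  proof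
    assume "{0} \<times> UNIV \<in> range (\<lambda>c. range (\<lambda>a :: 'a. (a, c *s a)))"
    then obtain c where "{0} \<times> UNIV = range (\<lambda>a :: 'a. (a, c *s a))" by blast
    then have "(0, x) \<in> range (\<lambda>a. (a, c *s a))" by blast
    then show False using x by auto
  qed
  ultimately show ?thesis by (simp add: lines_def card_image)
qed

lemma lines_inter: "X \<in> lines \<Longrightarrow> Y \<in> lines \<Longrightarrow> X \<noteq> Y \<Longrightarrow> X \<inter> Y = {0}"
  by (auto simp: lines_def prod_eq_iff)

text \<open>If a(x, y) lies in such a space with a nonzero, cancelling a gives x = 0 or y =
  cx.\<close>

lemma line_inter_orbit_space:
  assumes "X \<in> lines" "nondegenerate scale v"
  shows "X \<inter> orbit_space mult v = {0}"
proof -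
  have v: "fst v \<noteq> 0" "snd v \<noteq> c *s fst v" for c
    using assms(2) inj_comb2D unfolding nondegenerate_iff by blast+
  have "a = 0" if "act mult a v \<in> X" for a
  proof (rule ccontr)
    assume "a \<noteq> 0"
    with that assms(1) v(1) obtain c where "a \<odot> snd v = a \<odot> (c *s fst v)"
      by (auto simp: lines_def act_def mult_scale)
    with \<open>a \<noteq> 0\<close> v(2) show False by (simp add: mult_left_cancel)
  qed
  moreover have "0 \<in> X" using assms(1) by (auto simp: lines_def zero_prod_def image_iff)
  ultimately show ?thesis by (auto simp: mem_orbit_space)
qed

text \<open>For nonzero x, right multiplication by x is onto, so A(x, cx) is the set of all (b, cb),
  whatever x is.\<close>

lemma orbit_space_image_degenerate:
  "orbit_space mult ` {v. v \<noteq> 0 \<and> \<not> nondegenerate scale v} = lines"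
proof -
  have surj: "\<exists>a. b = a \<odot> x" if "x \<noteq> 0" for x b
    using bij_mult_right[OF that] by (metis bij_pointE)
  have vert: "orbit_space mult (0, y) = {0} \<times> UNIV" if "y \<noteq> 0" for y
    using surj[OF that] by (auto simp: orbit_space_def act_def)
  have line: "orbit_space mult (x, c *s x) = range (\<lambda>a. (a, c *s a))" if "x \<noteq> 0" for x c
    using surj[OF that] by (auto simp: orbit_space_def act_def mult_scale image_iff) metis
  obtain x :: 'a where x: "x \<noteq> 0" using independent_pair_exists inj_comb2D(1) by metis
  have "(0, x) \<noteq> 0 \<and> \<not> nondegenerate scale (0, x)"
    "(x, c *s x) \<noteq> 0 \<and> \<not> nondegenerate scale (x, c *s x)" for c
    using x by (auto simp: nondegenerate_iff inj_comb2_iff_not_multiple prod_eq_iff)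
  then have "lines \<subseteq> orbit_space mult ` {v. v \<noteq> 0 \<and> \<not> nondegenerate scale v}"
    using vert[OF x] line[OF x] unfolding lines_def by blast
  moreover have "orbit_space mult v \<in> lines" if v: "v \<noteq> 0" "\<not> nondegenerate scale v" for v
  proof (cases "fst v = 0")
    case True
    then show ?thesis using v(1) vert[of "snd v"] by (cases v) (auto simp: lines_def zero_prod_def)
  next
    case False
    then obtain c where "snd v = c *s fst v"
      using v(2) by (auto simp: nondegenerate_iff inj_comb2_iff_not_multiple)
    then show ?thesis using line[OF False, of c] by (cases v) (auto simp: lines_def)
  qed
  ultimately show ?thesis by blast
qed

lemma nondegenerate_orbit_space_notin_lines:
  "nondegenerate scale v \<Longrightarrow> orbit_space mult v \<notin> lines"
  using line_inter_orbit_space[of "orbit_space mult v" v] orbit_space_neq_0[of v]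
    nondegenerate_nonzero by auto

section \<open>The spaces meeting a given nondegenerate Av\<close>

text \<open>A space \<open>Aw\<close> meeting \<open>Av\<close> comes from some \<open>w = L\<^sub>b\<^sup>-\<^sup>1(av)\<close>; the pair \<open>(a, b)\<close> is
  determined by \<open>w\<close> up to a scalar, and \<open>w \<notin> Fv\<close> just when \<open>a, b\<close> are independent.\<close>

lemma card_meeting_vectors:
  assumes noncomm: "\<not> isotopic_to_commutative scale mult" and v: "nondegenerate scale v"
  defines "J \<equiv> {w. nondegenerate scale w \<and> orbit_space mult v \<inter> orbit_space mult w \<noteq> {0} \<and>
      w \<notin> range (\<lambda>c. scale_pair c v)}"
  shows "(CARD('f) - 1) * card J = (CARD('f) ^ 3 - 1) * (CARD('f) ^ 3 - CARD('f))"
proof -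
  let ?N = "{p. nondegenerate scale p}"
  have v0: "v \<noteq> 0" using v by (rule nondegenerate_nonzero)
  \<comment> \<open>\<open>f (a, b)\<close> is the solution w of bw = av, found by inverting left
    multiplication by b in each coordinate; it is meaningful for nonzero b.\<close>
  define f where "f = (\<lambda>p. (inv ((\<odot>) (snd p)) (fst p \<odot> fst v), inv ((\<odot>) (snd p)) (fst p \<odot> snd v)))"
  have act_f: "act mult b (f (a, b)) = act mult a v" if "b \<noteq> 0" for a b
    using bij_mult_left[OF that] by (simp add: f_def act_def bij_is_surj surj_f_inv_f)
  have f_eq_iff: "f (a, b) = w \<longleftrightarrow> act mult b w = act mult a v" if "b \<noteq> 0" for a b w
    using act_f[OF that, of a] act_left_cancel[OF that] by metis
  have N: "a \<noteq> 0" "b \<noteq> 0" "inj (comb2 a b)" if "(a, b) \<in> ?N" for a b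
    using that inj_comb2D by (auto simp: nondegenerate_iff)
  have not_multiple: "f (a, b) \<noteq> scale_pair c v" if "(a, b) \<in> ?N" for a b c
  proof
    assume "f (a, b) = scale_pair c v"
    then have "act mult (c *s b) v = act mult a v"
      using f_eq_iff[OF N(2)[OF that]] by (simp add: act_scale_pair)
    then have "c *s b = a" using act_right_cancel[OF v0] by blast
    then show False using inj_comb2D(4)[OF N(3)[OF that]] by blast
  qed
  have "f ` ?N = J"
  proof (intro equalityI subsetI)
    fix w assume "w \<in> f ` ?N"
    then obtain a b where ab: "(a, b) \<in> ?N" and w: "w = f (a, b)" by auto
    have eq: "act mult a v = act mult b w" unfolding w using act_f[OF N(2)[OF ab]] by simp
    then have "orbit_space mult v \<inter> orbit_space mult w \<noteq> {0}"
      unfolding orbit_spaces_meet_iff using N(1)[OF ab] v0 by auto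
    moreover have "nondegenerate scale w"
      using nondegenerate_transport[OF v eq N(1)[OF ab]] .
    ultimately show "w \<in> J" unfolding J_def w using not_multiple[OF ab] by blast
  next
    fix w assume "w \<in> J"
    then have w: "nondegenerate scale w" "w \<notin> range (\<lambda>c. scale_pair c v)"
      and "orbit_space mult v \<inter> orbit_space mult w \<noteq> {0}" unfolding J_def by auto
    then obtain a b where eq: "act mult a v = act mult b w" and ne: "act mult a v \<noteq> 0"
      unfolding orbit_spaces_meet_iff by blast
    from ne have a: "a \<noteq> 0" by simp
    from ne have b: "b \<noteq> 0" unfolding eq by simp
    \<comment> \<open>If b = ca, cancelling a gives v = cw, so w would lie in Fv.\<close>
    have "b \<noteq> c *s a" for c
    proof
      assume "b = c *s a"
      with eq have "act mult a v = act mult a (scale_pair c w)" by (simp add: act_scale_pair)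
      then have "v = scale_pair c w" using act_left_cancel[OF a] by blast
      with w(2) scale_pair_inverse[OF _ v0] show False by blast
    qed
    then have "(a, b) \<in> ?N" using a by (simp add: nondegenerate_iff inj_comb2_iff_not_multiple)
    moreover have "f (a, b) = w" using f_eq_iff[OF b] eq by simp
    ultimately show "w \<in> f ` ?N" by blast
  qed
  moreover have "card ?N = (CARD('f) - 1) * card (f ` ?N)"
  proof (rule card_eq_scale_pair_mult)
    show "0 \<notin> ?N" using nondegenerate_nonzero by blast
    fix p p' :: "'a \<times> 'a" assume p: "p \<in> ?N"
    obtain a b where ab: "p = (a, b)" by (cases p)
    obtain a' b' where ab': "p' = (a', b')" by (cases p')
    define w where "w = f (a, b)"
    have eq: "act mult a v = act mult b w"
      unfolding w_def using act_f N(2) p ab by simp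
    have a: "a \<noteq> 0" using N(1) p ab by blast
    then have w0: "w \<noteq> 0" using nondegenerate_transport[OF v eq] nondegenerate_nonzero by blast
    show "p' \<in> ?N \<and> f p' = f p \<longleftrightarrow> (\<exists>c. c \<noteq> 0 \<and> p' = scale_pair c p)"
    proof
      assume p': "p' \<in> ?N \<and> f p' = f p"
      then have eq': "act mult a' v = act mult b' w"
        using f_eq_iff[of b' a' w] N(2) ab ab' by (auto simp: w_def)
      \<comment> \<open>Independent a, a' would give Av and Aw a common plane and force w into
        Fv.\<close>
      have "\<not> inj (comb2 a a')"
        using shared_acts_imp_proportional[OF noncomm v _ eq eq'] not_multiple p ab
        by (auto simp: w_def)
      then obtain c where c: "a' = c *s a" using a by (auto simp: inj_comb2_iff_not_multiple)
      then have "act mult (c *s b) w = act mult b' w"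
        using eq eq' by (simp add: act_scale_pair)
      then have "c *s b = b'" using act_right_cancel[OF w0] by blast
      with c ab ab' have "p' = scale_pair c p" by (simp add: scale_pair_def)
      moreover have "p' \<noteq> 0" using p' nondegenerate_nonzero by blast
      ultimately show "\<exists>c. c \<noteq> 0 \<and> p' = scale_pair c p" by auto
    next
      assume "\<exists>c. c \<noteq> 0 \<and> p' = scale_pair c p"
      then obtain c where c: "c \<noteq> 0" "p' = scale_pair c p" by blast
      have N': "p' \<in> ?N" using c p nondegenerate_scale_pair by blast
      have "a' = c *s a" "b' = c *s b" using c ab ab' by (simp_all add: scale_pair_def)
      then have "act mult b' w = act mult a' v" using eq by (simp add: act_scale_pair)
      then have "f p' = w" using f_eq_iff[of b' a' w] N(2) N' ab' by blast
      with N' show "p' \<in> ?N \<and> f p' = f p" by (simp add: w_def ab)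
    qed
  qed
  ultimately show ?thesis by (simp add: card_nondegenerate)
qed

text \<open>Subtracting 1 removes Av itself. One factor q - 1 counts the pairs (a, b) giving the
  same w, the other the vectors w giving the same Aw.\<close>

lemma card_meeting_orbit_spaces:
  assumes noncomm: "\<not> isotopic_to_commutative scale mult" and v: "nondegenerate scale v"
  shows "(CARD('f) - 1)\<^sup>2 * (card (orbit_space mult ` {w. nondegenerate scale w \<and>
      orbit_space mult v \<inter> orbit_space mult w \<noteq> {0}}) - 1)
    = (CARD('f) ^ 3 - 1) * (CARD('f) ^ 3 - CARD('f))"
proof -
  define I where "I = {w. nondegenerate scale w \<and> orbit_space mult v \<inter> orbit_space mult w \<noteq> {0}}"
  define J where "J = {w. nondegenerate scale w \<and> orbit_space mult v \<inter> orbit_space mult w \<noteq> {0} \<and>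
      w \<notin> range (\<lambda>c. scale_pair c v)}"
  have v0: "v \<noteq> 0" using v by (rule nondegenerate_nonzero)
  have IJ: "J \<subseteq> I" "\<And>w. w \<in> I \<Longrightarrow> w \<in> J \<or> (\<exists>c. w = scale_pair c v)"
    by (auto simp: I_def J_def)
  have "v \<in> I" using v orbit_space_neq_0[OF v0] by (simp add: I_def)
  have "orbit_space mult w = orbit_space mult v" if "w \<in> I" "w = scale_pair c v" for w c
    using that nondegenerate_nonzero[of w] orbit_space_scale_pair[of c v] by (auto simp: I_def)
  then have "orbit_space mult ` I = insert (orbit_space mult v) (orbit_space mult ` J)"
    using \<open>v \<in> I\<close> IJ by blast
  moreover have "orbit_space mult v \<notin> orbit_space mult ` J"
    using orbit_space_eq_iff[OF noncomm v] nondegenerate_nonzero unfolding J_def by blast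
  ultimately have "card (orbit_space mult ` I) - 1 = card (orbit_space mult ` J)" by simp
  moreover have "card J = (CARD('f) - 1) * card (orbit_space mult ` J)"
  proof (rule card_eq_scale_pair_mult)
    show "0 \<notin> J" using nondegenerate_nonzero by (auto simp: J_def)
    fix w w' assume w: "w \<in> J"
    show "w' \<in> J \<and> orbit_space mult w' = orbit_space mult w \<longleftrightarrow> (\<exists>c. c \<noteq> 0 \<and> w' = scale_pair c w)"
    proof
      assume "w' \<in> J \<and> orbit_space mult w' = orbit_space mult w"
      then show "\<exists>c. c \<noteq> 0 \<and> w' = scale_pair c w"
        using orbit_space_eq_iff[OF noncomm, of w w'] w nondegenerate_nonzero unfolding J_def by blast
    next
      assume "\<exists>c. c \<noteq> 0 \<and> w' = scale_pair c w"
      then obtain c where c: "c \<noteq> 0" "w' = scale_pair c w" by blast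
      have "w = scale_pair (inverse c * d) v" if "w' = scale_pair d v" for d
        using c that by (metis left_inverse scale_pair_scale_pair)
      then have "w' \<notin> range (\<lambda>c. scale_pair c v)" using w unfolding J_def by blast
      then show "w' \<in> J \<and> orbit_space mult w' = orbit_space mult w"
        using w c nondegenerate_scale_pair by (simp add: J_def orbit_space_scale_pair)
    qed
  qed
  ultimately show ?thesis
    using card_meeting_vectors[OF noncomm v, folded J_def]
    by (simp add: I_def power2_eq_square mult.assoc)
qed

end

section \<open>The two counts\<close>

theorem proposition9p16:
  fixes scale :: "'f::{field, finite} \<Rightarrow> 'a::ab_group_add \<Rightarrow> 'a"
    and mult :: "'a \<Rightarrow> 'a \<Rightarrow> 'a"
    and q :: int and v :: "'a \<times> 'a"
  assumes "q = int (card (UNIV :: 'f set))"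
    and "division_algebra_over scale mult"
    and "vector_space.dim scale (UNIV :: 'a set) = 3"
    and "\<not> associative_mult mult"
    and "\<not> isotopic_to_commutative scale mult"
    and "v \<noteq> 0"
  shows "(nondegenerate scale v \<longrightarrow>
           int (card {orbit_space mult v' | v'. v' \<noteq> 0 \<and> orbit_space mult v \<inter> orbit_space mult v' = {0}})
             = q ^ 5 - 2 * q ^ 3 - 3 * q ^ 2 - q) \<and>
         (\<not> nondegenerate scale v \<longrightarrow>
           int (card {orbit_space mult v' | v'. v' \<noteq> 0 \<and> orbit_space mult v \<inter> orbit_space mult v' = {0}})
             = q ^ 2 * (q ^ 3 + q ^ 2 - 1))"
proof -
  interpret division_algebra_over scale mult by (rule assms(2))
  interpret cubic_division_algebra scale mult by unfold_locales (rule assms(3))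
  let ?O = "orbit_space mult"
  define N where "N = {w. nondegenerate scale w}"
  define S where "S = {?O v' | v'. v' \<noteq> 0 \<and> ?O v \<inter> ?O v' = {0}}"
  have q: "q > 1" using q_gt_1 assms(1) by simp
  \<comment> \<open>Together with q > 1, this makes the natural-number subtractions in the counts
    agree with integer ones.\<close>
  have le: "CARD('f) \<le> CARD('f) ^ 3" using q_gt_1 by (simp add: self_le_power)
  have int: "int (CARD('f) - 1) = q - 1" "int (CARD('f) ^ 3 - 1) = q ^ 3 - 1"
    "int (CARD('f) ^ 3 - CARD('f)) = q ^ 3 - q"
    using q_gt_1 le by (simp_all add: assms(1) of_nat_diff)
  \<comment> \<open>These expose the factors q - 1 and (q - 1)^2 that are cancelled below.\<close>
  have prod: "(q ^ 3 - 1) * (q ^ 3 - q) = (q - 1) * ((q\<^sup>2 + q + 1) * (q ^ 3 - q))"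
    "(q ^ 3 - 1) * (q ^ 3 - q) = (q - 1)\<^sup>2 * ((q\<^sup>2 + q + 1) * (q\<^sup>2 + q))"
    by algebra+
  have "(q - 1) * int (card (?O ` N)) = (q ^ 3 - 1) * (q ^ 3 - q)"
    using arg_cong[OF card_nondegenerate_orbit_spaces[OF assms(5)], of int]
    unfolding of_nat_mult int N_def .
  then have cardN: "int (card (?O ` N)) = (q\<^sup>2 + q + 1) * (q ^ 3 - q)"
    unfolding prod(1) using q by simp
  have nonzero: "{w. w \<noteq> 0} = N \<union> {w. w \<noteq> 0 \<and> \<not> nondegenerate scale w}"
    using nondegenerate_nonzero by (auto simp: N_def)
  have "?O ` {w. w \<noteq> 0} = ?O ` N \<union> lines"
    by (subst nonzero) (simp only: image_Un orbit_space_image_degenerate)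
  moreover have "S = {X \<in> ?O ` {w. w \<noteq> 0}. ?O v \<inter> X = {0}}"
    unfolding S_def by blast
  ultimately have S: "S = {X \<in> ?O ` N. ?O v \<inter> X = {0}} \<union> {X \<in> lines. ?O v \<inter> X = {0}}"
    by (simp only: Un_iff conj_disj_distribR Collect_disj_eq)
  have disj: "?O ` N \<inter> lines = {}"
    using nondegenerate_orbit_space_notin_lines by (auto simp: N_def)
  then have cardS: "card S = card {X \<in> ?O ` N. ?O v \<inter> X = {0}} + card {X \<in> lines. ?O v \<inter> X = {0}}"
    unfolding S by (intro card_Un_disjoint) (auto simp: lines_def)
  \<comment> \<open>Every space of a degenerate vector qualifies; from those of nondegenerate
    vectors, the ones meeting Av are removed, Av included.\<close>
  have "int (card S) = q ^ 5 - 2 * q ^ 3 - 3 * q ^ 2 - q" if v: "nondegenerate scale v"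
  proof -
    define I where "I = ?O ` {w. nondegenerate scale w \<and> ?O v \<inter> ?O w \<noteq> {0}}"
    \<comment> \<open>Hence \<open>card I\<close> is positive and \<open>card I - 1\<close> is not
      truncated.\<close>
    have "?O v \<in> I" using v orbit_space_neq_0[OF assms(6)] by (simp add: I_def)
    then have "card I > 0" by (auto simp: card_gt_0_iff I_def)
    then have "int (card I - 1) = int (card I) - 1" by (simp add: of_nat_diff)
    moreover have "(q - 1)\<^sup>2 * int (card I - 1) = (q ^ 3 - 1) * (q ^ 3 - q)"
      using arg_cong[OF card_meeting_orbit_spaces[OF assms(5) v], of int]
      unfolding of_nat_mult of_nat_power int I_def .
    ultimately have cardI: "int (card I) = (q\<^sup>2 + q + 1) * (q\<^sup>2 + q) + 1"
      unfolding prod(2) using q by simp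
    have "I \<subseteq> ?O ` N" by (auto simp: I_def N_def)
    moreover have "{X \<in> ?O ` N. ?O v \<inter> X = {0}} = ?O ` N - I"
      by (auto simp: I_def N_def)
    ultimately have "int (card {X \<in> ?O ` N. ?O v \<inter> X = {0}}) = int (card (?O ` N)) - int (card I)"
      by (simp add: card_Diff_subset finite_subset[of I] of_nat_diff card_mono)
    moreover have "{X \<in> lines. ?O v \<inter> X = {0}} = lines"
      using line_inter_orbit_space[OF _ v] by (auto simp: Int_commute)
    ultimately have "int (card S) = (q\<^sup>2 + q + 1) * (q ^ 3 - q) - ((q\<^sup>2 + q + 1) * (q\<^sup>2 + q) + 1) + (q + 1)"
      by (simp add: cardS cardN cardI card_lines assms(1))
    then show ?thesis by algebra
  qed
  \<comment> \<open>Now Av is one of the q + 1 spaces in \<open>lines\<close>. It meets the q others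
    and all spaces of nondegenerate vectors trivially, so only Av itself is excluded.\<close>
  moreover have "int (card S) = q ^ 2 * (q ^ 3 + q ^ 2 - 1)" if v: "\<not> nondegenerate scale v"
  proof -
    have vl: "?O v \<in> lines" using v assms(6) orbit_space_image_degenerate by blast
    then have "{X \<in> ?O ` N. ?O v \<inter> X = {0}} = ?O ` N"
      using line_inter_orbit_space by (auto simp: N_def)
    moreover have "{X \<in> lines. ?O v \<inter> X = {0}} = lines - {?O v}"
      using lines_inter[OF vl] orbit_space_neq_0[OF assms(6)] by auto
    ultimately have "int (card S) = (q\<^sup>2 + q + 1) * (q ^ 3 - q) + q"
      using vl by (simp add: cardS cardN card_lines assms(1))
    then show ?thesis by algebra
  qed
  ultimately show ?thesis unfolding S_def by blast
qed

end
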